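(* Let $\gamma:\mathbb{S}^1\to\mathbb{R}^2$ be a Lipschitz map which is a homeomorphism onto its image, satisfies $|\gamma'|=1$ a.e. in $\mathbb{S}^1$, and is convex in $\mathbb{S}^1$. If for some $s\in(0,1)$ and some $p\ge\frac1s$ one has $\mathscr{W}_{s,p}(\gamma)<+\infty$, then $\gamma\in C^1(\mathbb{S}^1,\mathbb{R}^2)$.
   Context: $\mathbb{S}^1$ is the unit circle, identified with $\mathbb{R}/2\pi\mathbb{Z}$; derivatives are with respect to arclength. For $v=(v_1,v_2)\in\mathbb{R}^2$ put $v^\perp=(v_2,-v_1)$. A continuous $\gamma:\mathbb{S}^1\to\mathbb{R}^2$ is called convex in $\mathbb{S}^1$ if for every $x\in\mathbb{S}^1$ there is a unit vector $\nu_x\in\mathbb{R}^2$ with $\nu_x\cdot(\gamma(x)-\gamma(y))\ge0$ for all $y\in\mathbb{S}^1$. With $n(\gamma(y)):=\gamma'(y)^\perp$ (defined for a.e. $y$), set $$\mathscr{W}_{s,p}(\gamma)=\int_{\mathbb{S}^1}\left|\int_{\mathbb{S}^1}\frac{\langle n(\gamma(y)),\gamma(y)-\gamma(x)\rangle}{|\gamma(y)-\gamma(x)|^{2+s}}\,dy\right|^p dx\in[0,+\infty].$$ For such $\gamma$ the inner integrand has, up to null sets, a constant sign depending only on the orientation of $\gamma$. *)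

theory Defs
  imports "HOL-Analysis.Analysis"
begin

text \<open>
  The circle is the set \<open>sphere (0::complex) 1\<close>, and \<open>t \<mapsto> cis t\<close> is its arclength
  parametrisation, which identifies it with the reals modulo \<open>2 * pi\<close>.
  Arclength derivatives and integrals over the circle are taken in the variable \<open>t\<close>.
\<close>

abbreviation circle :: "complex set" where
  "circle \<equiv> sphere 0 1"

abbreviation arclength :: "real measure" where
  "arclength \<equiv> lebesgue_on {0..2 * pi}"

definition perp :: "real ^ 2 \<Rightarrow> real ^ 2" where
  "perp v = vector [v $ 2, - (v $ 1)]"

definition convex_in_circle :: "(complex \<Rightarrow> real ^ 2) \<Rightarrow> bool" where
  "convex_in_circle \<gamma> \<longleftrightarrow>
     (\<forall>x\<in>circle. \<exists>\<nu>. norm \<nu> = 1 \<and> (\<forall>y\<in>circle. \<nu> \<bullet> (\<gamma> x - \<gamma> y) \<ge> 0))"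

text \<open>The value at \<open>t\<close> is arbitrary where the derivative does not exist.\<close>

definition arc_deriv :: "(complex \<Rightarrow> real ^ 2) \<Rightarrow> real \<Rightarrow> real ^ 2" where
  "arc_deriv \<gamma> t = vector_derivative (\<lambda>u. \<gamma> (cis u)) (at t)"

definition normal :: "(complex \<Rightarrow> real ^ 2) \<Rightarrow> real \<Rightarrow> real ^ 2" where
  "normal \<gamma> t = perp (arc_deriv \<gamma> t)"

text \<open>
  The Lebesgue integral of a signed function as an extended real number. The Bochner integral
  \<open>integral\<^sup>L\<close> would be \<open>0\<close> for a function that is not integrable, e.g. a nonnegative function
  with infinite integral. If the positive and the negative part both have
  infinite integral, the value is \<open>\<infinity> - \<infinity> = \<infinity>\<close>.
\<close>

definition ext_integral :: "'a measure \<Rightarrow> ('a \<Rightarrow> real) \<Rightarrow> ereal" where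
  "ext_integral M f =
     enn2ereal (\<integral>\<^sup>+x. ennreal (f x) \<partial>M) - enn2ereal (\<integral>\<^sup>+x. ennreal (- f x) \<partial>M)"

definition ennreal_powr :: "ennreal \<Rightarrow> real \<Rightarrow> ennreal" where
  \<comment> \<open>used for positive exponents only\<close>
  "ennreal_powr a p = (if a = \<infinity> then \<infinity> else ennreal (enn2real a powr p))"

definition W_energy :: "real \<Rightarrow> real \<Rightarrow> (complex \<Rightarrow> real ^ 2) \<Rightarrow> ennreal" where
  "W_energy s p \<gamma> =
     (\<integral>\<^sup>+x. ennreal_powr
        (e2ennreal \<bar>ext_integral arclength
           (\<lambda>y. (normal \<gamma> y \<bullet> (\<gamma> (cis y) - \<gamma> (cis x)))
                 / norm (\<gamma> (cis y) - \<gamma> (cis x)) powr (2 + s))\<bar>) p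
      \<partial>arclength)"

end

theory Submission
  imports Defs
begin

text \<open>
  At a point where the derivative exists with unit length, convexity forces the supporting line
  to be the tangent line, and the whole curve lies on one side of it; because the convex
  hull has interior points, that side cannot switch along the curve. Near any \<open>t0\<close> the curve is a
  graph whose slope is monotone where it is defined. If the slope does not jump at \<open>t0\<close>, the curve
  is strictly differentiable there, and strict differentiability everywhere implies \<open>C1\<close>. If it
  jumps, then for \<open>x = t0 - r\<close> the inner integral is at least a multiple of \<open>r powr (- s)\<close>, by
  integrating only over \<open>t0 < y < t0 + r\<close>, where the numerator is of order \<open>r\<close>; the \<open>p\<close>-th power
  is not integrable in \<open>r\<close> because \<open>s * p \<ge> 1\<close>.
\<close>

subsection \<open>Rotation by a right angle\<close>

lemma inner_real2: "(v::real^2) \<bullet> w = v$1 * w$1 + v$2 * w$2"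
  by (simp add: inner_vec_def sum_2)

lemma perp_nth [simp]: "perp v $ 1 = v $ 2" "perp v $ 2 = - (v $ 1)"
  by (simp_all add: perp_def)

lemma inner_perp_perp [simp]: "perp v \<bullet> perp w = v \<bullet> w"
  by (simp add: inner_real2)

lemma perp_perp [simp]: "perp (perp v) = - v"
  by (simp add: vec_eq_iff forall_2)

lemma inner_perp_left: "perp v \<bullet> w = - (v \<bullet> perp w)"
  by (simp add: inner_real2)

lemma inner_perp_self [simp]: "v \<bullet> perp v = 0" "perp v \<bullet> v = 0"
  by (simp_all add: inner_real2)

lemma norm_perp [simp]: "norm (perp v) = norm v"
  by (simp add: norm_eq_sqrt_inner)

lemma linear_perp: "linear perp"
  by (rule linearI) (simp_all add: vec_eq_iff forall_2)

text \<open>\<open>f\<close> and \<open>perp f\<close> are orthogonal and equally long. Keeping the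
  factor \<open>f \<bullet> f\<close> avoids normalising \<open>f\<close>.\<close>

lemma frame_expansion:
  "(f \<bullet> f) *\<^sub>R v = (v \<bullet> f) *\<^sub>R f + (v \<bullet> perp f) *\<^sub>R perp f"
  by (simp add: vec_eq_iff forall_2 inner_real2 algebra_simps)

lemma inner_frame_expansion:
  "(f \<bullet> f) * (v \<bullet> w) = (v \<bullet> f) * (w \<bullet> f) + (v \<bullet> perp f) * (w \<bullet> perp f)"
  by (simp add: inner_real2 algebra_simps)

subsection \<open>Lipschitz functions and strict differentiability\<close>

text \<open>
  The image of the exceptional null set is null, so some value strictly between
  \<open>h a - K a\<close> and \<open>h b - K b\<close> is attained by \<open>h t - K t\<close> only at good points; the last
  crossing of that value contradicts the sign of the derivative.
\<close>

lemma lipschitz_mean_value_le: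
  fixes h :: "real \<Rightarrow> real"
  assumes lip: "L-lipschitz_on {a..b} h" and neg: "negligible S" and ab: "a \<le> b"
    and der: "\<And>t. \<lbrakk>a < t; t < b; t \<notin> S\<rbrakk> \<Longrightarrow> \<exists>D\<le>K. (h has_real_derivative D) (at t)"
  shows "h b - h a \<le> K * (b - a)"
proof (rule ccontr)
  assume contr: "\<not> h b - h a \<le> K * (b - a)"
  then have "a < b" using ab by (cases "a = b") auto
  \<comment> \<open>Half the excess of the mean slope over \<open>K\<close>: then \<open>g\<close>
    still rises from \<open>a\<close> to \<open>b\<close>, although its derivative at good points is
    at most \<open>- e\<close>.\<close>
  define e where "e = (h b - h a - K * (b - a)) / (2 * (b - a))"
  have e: "e > 0" using contr \<open>a < b\<close> by (simp add: e_def)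
  define g where "g t = h t - (K + e) * t" for t
  have "e * (b - a) = (h b - h a - K * (b - a)) / 2"
    using \<open>a < b\<close> by (simp add: e_def field_simps)
  then have gab: "g a < g b" using contr by (simp add: g_def algebra_simps)
  have cont_h: "continuous_on {a..b} h" using lip by (rule lipschitz_on_continuous_on)
  then have cont: "continuous_on {a..b} g"
    unfolding g_def by (intro continuous_intros)
  have "negligible (g ` (S \<inter> {a..b}))"
  proof (rule negligible_locally_Lipschitz_image)
    show "negligible (S \<inter> {a..b})" using neg by (simp add: negligible_Int)
    fix x assume x: "x \<in> S \<inter> {a..b}"
    have "norm (g y - g x) \<le> (L + \<bar>K + e\<bar>) * norm (y - x)" if "y \<in> S \<inter> {a..b} \<inter> UNIV" for y
    proof -
      have "\<bar>h y - h x\<bar> \<le> L * \<bar>y - x\<bar>"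
        using lipschitz_onD[OF lip, of y x] x that by (simp add: dist_real_def)
      moreover have "\<bar>(K + e) * (y - x)\<bar> = \<bar>K + e\<bar> * \<bar>y - x\<bar>" by (rule abs_mult)
      moreover have "g y - g x = (h y - h x) - (K + e) * (y - x)"
        by (simp add: g_def algebra_simps)
      ultimately show ?thesis by (simp add: distrib_right)
    qed
    then show "\<exists>T B. open T \<and> x \<in> T \<and> (\<forall>y\<in>S \<inter> {a..b} \<inter> T. norm (g y - g x) \<le> B * norm (y - x))"
      by (intro exI[of _ UNIV] exI[of _ "L + \<bar>K + e\<bar>"]) blast
  qed simp
  moreover have "\<not> negligible {g a<..<g b}"
    using gab by (metis box_real(1) negligible_interval(2) greaterThanLessThan_empty_iff not_le)
  ultimately obtain v where v: "g a < v" "v < g b" "v \<notin> g ` (S \<inter> {a..b})"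
    by (meson greaterThanLessThan_iff negligible_subset subsetI)
  define T where "T = {t \<in> {a..b}. g t \<le> v}"
  have "closed ({a..b} \<inter> g -` {..v})"
    using cont by (intro continuous_closed_preimage) auto
  then have "closed T" by (simp add: T_def vimage_def Int_def)
  then have "compact T"
    by (metis (no_types, lifting) T_def bounded_closed_interval bounded_subset compact_eq_bounded_closed mem_Collect_eq subsetI)
  moreover have "T \<noteq> {}" using v ab by (force simp: T_def)
  ultimately obtain t where t: "t \<in> T" and tmax: "\<And>u. u \<in> T \<Longrightarrow> u \<le> t"
    using compact_attains_sup[of T] by metis
  have tb: "a \<le> t" "t < b" using t v by (auto simp: T_def less_le)
  have "g t = v"
  proof (rule ccontr)
    assume "g t \<noteq> v"
    then have "g t \<le> v" using t by (simp add: T_def)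
    moreover have "continuous_on {t..b} g" using cont tb by (auto intro: continuous_on_subset)
    ultimately obtain u where "t \<le> u" "u \<le> b" "g u = v"
      using IVT'[of g t v b] v tb by auto
    then show False using tmax[of u] tb \<open>g t \<noteq> v\<close> by (auto simp: T_def)
  qed
  then have "a < t" using tb v by (cases "a = t") auto
  have "t \<notin> S" using v \<open>g t = v\<close> tb by auto
  then obtain D where D: "D \<le> K" "(h has_real_derivative D) (at t)"
    using der \<open>a < t\<close> tb by blast
  have "(g has_real_derivative (D - (K + e))) (at t)"
    unfolding g_def by (auto intro!: derivative_eq_intros D)
  then obtain d where d: "d > 0" "\<And>x. 0 < x \<Longrightarrow> x < d \<Longrightarrow> g (t + x) < g t"
    using DERIV_neg_dec_right[of g "D - (K + e)" t] D e by auto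
  define x where "x = min (d / 2) (b - t)"
  have "0 < x" "x < d" "t + x \<le> b" using d tb by (auto simp: x_def)
  then have "t + x \<in> T" using d(2)[of x] \<open>g t = v\<close> tb by (simp add: T_def)
  then show False using tmax[of "t + x"] \<open>0 < x\<close> by simp
qed

lemma lipschitz_inner_mean_value_le:
  fixes f :: "real \<Rightarrow> 'a::euclidean_space"
  assumes lip: "L-lipschitz_on UNIV f" and neg: "negligible S" and ab: "a \<le> b"
    and der: "\<And>t. \<lbrakk>a < t; t < b; t \<notin> S\<rbrakk> \<Longrightarrow>
                f differentiable (at t) \<and> vector_derivative f (at t) \<bullet> w \<le> K"
  shows "(f b - f a) \<bullet> w \<le> K * (b - a)"
proof -
  have "(L * norm w)-lipschitz_on {a..b} (\<lambda>t. f t \<bullet> w)"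
  proof (rule lipschitz_onI)
    fix x y
    have "\<bar>(f x - f y) \<bullet> w\<bar> \<le> norm (f x - f y) * norm w" by (rule Cauchy_Schwarz_ineq2)
    also have "\<dots> \<le> (L * dist x y) * norm w"
      using lipschitz_onD[OF lip, of x y] by (intro mult_right_mono) (auto simp: dist_norm)
    finally show "dist (f x \<bullet> w) (f y \<bullet> w) \<le> L * norm w * dist x y"
      by (simp add: dist_real_def inner_diff_left mult.commute mult.left_commute)
  qed (use lipschitz_on_nonneg[OF lip] in simp)
  then have "f b \<bullet> w - f a \<bullet> w \<le> K * (b - a)"
    using neg ab
  proof (rule lipschitz_mean_value_le)
    fix t assume t: "a < t" "t < b" "t \<notin> S"
    then have "(f has_vector_derivative vector_derivative f (at t)) (at t)"
      using der vector_derivative_works by blast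
    then have "((\<lambda>t. f t \<bullet> w) has_real_derivative (vector_derivative f (at t) \<bullet> w)) (at t)"
      unfolding has_real_derivative_iff_has_vector_derivative
      by (auto simp: has_vector_derivative_def intro!: derivative_eq_intros)
    then show "\<exists>D\<le>K. ((\<lambda>t. f t \<bullet> w) has_real_derivative D) (at t)"
      using der[OF t] by blast
  qed
  then show ?thesis by (simp add: inner_diff_left)
qed

lemma lipschitz_norm_mean_value_le:
  fixes f :: "real \<Rightarrow> 'a::euclidean_space"
  assumes lip: "L-lipschitz_on UNIV f" and neg: "negligible S" and ab: "a \<le> b"
    and der: "\<And>t. \<lbrakk>a < t; t < b; t \<notin> S\<rbrakk> \<Longrightarrow>
                f differentiable (at t) \<and> norm (vector_derivative f (at t) - d) \<le> K"
  shows "norm (f b - f a - (b - a) *\<^sub>R d) \<le> K * (b - a)"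
proof -
  \<comment> \<open>Testing against the direction of the error turns its norm into an inner product.
    Since \<open>sgn 0 = 0\<close>, only \<open>norm w \<le> 1\<close> holds in general.\<close>
  define w where "w = sgn (f b - f a - (b - a) *\<^sub>R d)"
  have w: "norm w \<le> 1" by (simp add: w_def norm_sgn)
  have "(f b - f a) \<bullet> w \<le> (K + d \<bullet> w) * (b - a)"
    using lip neg ab
  proof (rule lipschitz_inner_mean_value_le)
    fix t assume t: "a < t" "t < b" "t \<notin> S"
    have "(vector_derivative f (at t) - d) \<bullet> w \<le> norm (vector_derivative f (at t) - d) * norm w"
      by (rule norm_cauchy_schwarz)
    also have "\<dots> \<le> norm (vector_derivative f (at t) - d) * 1"
      using w by (intro mult_left_mono) auto
    finally show "f differentiable (at t) \<and> vector_derivative f (at t) \<bullet> w \<le> K + d \<bullet> w"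
      using der[OF t] by (simp add: inner_diff_left)
  qed
  then have "(f b - f a - (b - a) *\<^sub>R d) \<bullet> w \<le> K * (b - a)"
    by (simp add: algebra_simps)
  moreover have "(f b - f a - (b - a) *\<^sub>R d) \<bullet> w = norm (f b - f a - (b - a) *\<^sub>R d)"
    by (cases "f b - f a - (b - a) *\<^sub>R d = 0")
      (simp_all add: w_def sgn_div_norm power2_norm_eq_inner[symmetric] power2_eq_square)
  ultimately show ?thesis by simp
qed

text \<open>Both endpoints of the chord vary independently, unlike in ordinary differentiability;
  this uniformity forces the derivative to be continuous.\<close>

definition strictly_differentiable_at :: "(real \<Rightarrow> 'a::real_normed_vector) \<Rightarrow> 'a \<Rightarrow> real \<Rightarrow> bool" where
  "strictly_differentiable_at f d t \<longleftrightarrow>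
     (\<forall>\<eta>>0. \<exists>\<delta>>0. \<forall>x y. \<bar>x - t\<bar> < \<delta> \<longrightarrow> \<bar>y - t\<bar> < \<delta> \<longrightarrow>
        norm (f y - f x - (y - x) *\<^sub>R d) \<le> \<eta> * \<bar>y - x\<bar>)"

lemma strictly_differentiable_imp_has_vector_derivative:
  assumes "strictly_differentiable_at f d t"
  shows "(f has_vector_derivative d) (at t)"
  unfolding has_vector_derivative_def has_derivative_at_alt
proof (intro conjI allI impI)
  fix e :: real assume "e > 0"
  then obtain \<delta> where "\<delta> > 0" and
    "\<And>x y. \<bar>x - t\<bar> < \<delta> \<Longrightarrow> \<bar>y - t\<bar> < \<delta> \<Longrightarrow> norm (f y - f x - (y - x) *\<^sub>R d) \<le> e * \<bar>y - x\<bar>"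
    using assms unfolding strictly_differentiable_at_def by blast
  then show "\<exists>\<delta>>0. \<forall>y. norm (y - t) < \<delta> \<longrightarrow> norm (f y - f t - (y - t) *\<^sub>R d) \<le> e * norm (y - t)"
    by (intro exI[of _ \<delta>]) auto
qed (rule bounded_linear_scaleR_left)

text \<open>For \<open>u\<close> close to \<open>t\<close>, a short chord starting at
  \<open>u\<close> is approximated both by a multiple of \<open>D u\<close> and by the same multiple
  of \<open>D t\<close>; comparing the two bounds \<open>D u - D t\<close>.\<close>

lemma strictly_differentiable_imp_C1:
  fixes f :: "real \<Rightarrow> 'a::real_normed_vector"
  assumes "\<And>t. \<exists>d. strictly_differentiable_at f d t"
  shows "f C1_differentiable_on UNIV"
proof -
  obtain D where D: "\<And>t. strictly_differentiable_at f (D t) t" using assms by metis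
  have "isCont D t" for t
    unfolding continuous_at_eps_delta
  proof (intro allI impI)
    fix e :: real assume "e > 0"
    then obtain \<delta> where \<delta>: "\<delta> > 0" and
      *: "\<And>x y. \<bar>x - t\<bar> < \<delta> \<Longrightarrow> \<bar>y - t\<bar> < \<delta> \<Longrightarrow> norm (f y - f x - (y - x) *\<^sub>R D t) \<le> (e/3) * \<bar>y - x\<bar>"
      using D[of t] unfolding strictly_differentiable_at_def by (metis divide_pos_pos zero_less_numeral)
    have "dist (D u) (D t) < e" if u: "dist u t < \<delta>" for u
    proof -
      obtain \<delta>' where \<delta>': "\<delta>' > 0" and
        **: "\<And>x y. \<bar>x - u\<bar> < \<delta>' \<Longrightarrow> \<bar>y - u\<bar> < \<delta>' \<Longrightarrow> norm (f y - f x - (y - x) *\<^sub>R D u) \<le> (e/3) * \<bar>y - x\<bar>"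
        using D[of u] \<open>e > 0\<close> unfolding strictly_differentiable_at_def by (metis divide_pos_pos zero_less_numeral)
      \<comment> \<open>Small enough that \<open>u + k\<close> stays in the neighbourhoods on which
        the estimates at \<open>u\<close> and at \<open>t\<close> hold.\<close>
      define k where "k = min \<delta>' (\<delta> - \<bar>u - t\<bar>) / 2"
      have k: "k > 0" "k < \<delta>'" "\<bar>u + k - t\<bar> < \<delta>"
        using u \<delta>' unfolding k_def dist_real_def min_def by (auto simp: abs_if field_simps split: if_splits)
      have "norm (k *\<^sub>R (D u - D t)) = norm ((f (u + k) - f u - k *\<^sub>R D t) - (f (u + k) - f u - k *\<^sub>R D u))"
        by (simp add: algebra_simps)
      also have "\<dots> \<le> norm (f (u + k) - f u - k *\<^sub>R D t) + norm (f (u + k) - f u - k *\<^sub>R D u)"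
        by (rule norm_triangle_ineq4)
      also have "\<dots> \<le> e/3 * k + e/3 * k"
        using *[of u "u + k"] **[of u "u + k"] u k \<delta>'
        by (intro add_mono) (simp_all add: dist_real_def)
      also have "norm (k *\<^sub>R (D u - D t)) = k * norm (D u - D t)" using k by simp
      finally have "k * norm (D u - D t) \<le> k * (2 * e / 3)" by (simp add: algebra_simps)
      then have "norm (D u - D t) \<le> 2 * e / 3" using k(1) by (simp only: mult_le_cancel_left_pos)
      then show ?thesis using \<open>e > 0\<close> by (simp add: dist_norm)
    qed
    then show "\<exists>d>0. \<forall>x'. dist x' t < d \<longrightarrow> dist (D x') (D t) < e" using \<delta> by blast
  qed
  then have "continuous_on UNIV D" by (simp add: continuous_at_imp_continuous_on)
  then show ?thesis
    unfolding C1_differentiable_on_def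
    using strictly_differentiable_imp_has_vector_derivative[OF D] by blast
qed

subsection \<open>Convex curves of unit speed\<close>

definition unit_speed_at :: "(real \<Rightarrow> real^2) \<Rightarrow> real \<Rightarrow> bool" where
  "unit_speed_at c t \<longleftrightarrow> c differentiable (at t) \<and> norm (vector_derivative c (at t)) = 1"

text \<open>The curve is lifted to the real line. The equivalence \<open>eq_iff\<close> expresses at
  once that it has period \<open>2 * pi\<close> and is injective on the circle.\<close>

locale convex_loop =
  fixes c :: "real \<Rightarrow> real^2" and L :: real
  assumes lipschitz: "L-lipschitz_on UNIV c"
    and eq_iff: "c x = c y \<longleftrightarrow> cis x = cis y"
    and unit_speed: "negligible {t. \<not> unit_speed_at c t}"
    and support: "\<exists>\<nu>. norm \<nu> = 1 \<and> (\<forall>u. \<nu> \<bullet> (c t - c u) \<ge> 0)"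
begin

abbreviation tangent :: "real \<Rightarrow> real^2" where
  "tangent t \<equiv> vector_derivative c (at t)"

lemma continuous: "continuous_on A c"
  using lipschitz_on_continuous_on[OF lipschitz] by (rule continuous_on_subset) simp

lemma norm_diff_le: "norm (c x - c y) \<le> L * \<bar>x - y\<bar>"
  using lipschitz_onD[OF lipschitz, of x y] by (simp add: dist_norm)

lemma has_tangent:
  "unit_speed_at c t \<Longrightarrow> (c has_vector_derivative tangent t) (at t)"
  by (simp add: unit_speed_at_def vector_derivative_works)

lemma has_real_derivative_inner:
  assumes "unit_speed_at c t"
  shows "((\<lambda>u. c u \<bullet> w) has_real_derivative tangent t \<bullet> w) (at t)"
  using has_tangent[OF assms] unfolding has_real_derivative_iff_has_vector_derivative
  by (auto simp: has_vector_derivative_def intro!: derivative_eq_intros)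

lemma ex_unit_speed_between:
  assumes "a < b"
  shows "\<exists>t. a < t \<and> t < b \<and> unit_speed_at c t"
proof (rule ccontr)
  assume "\<not> ?thesis"
  then have "{a<..<b} \<subseteq> {t. \<not> unit_speed_at c t}" by auto
  then have "negligible {a<..<b}" using unit_speed negligible_subset by blast
  then show False
    using assms by (metis box_real(1) negligible_interval(2) greaterThanLessThan_empty_iff not_le)
qed

section \<open>Injectivity within a period and interior points of the convex hull\<close>

lemma eq_imp_eq:
  assumes "c x = c y" "\<bar>x - y\<bar> < 2 * pi"
  shows "x = y"
proof -
  have "sin x = sin y \<and> cos x = cos y" using assms(1) by (simp add: eq_iff complex_eq_iff)
  then obtain n :: int where n: "x = y + 2 * pi * n" using sin_cos_eq_iff by blast
  then have "2 * pi * \<bar>real_of_int n\<bar> < 2 * pi * 1" using assms(2) by (simp add: abs_mult)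
  then have "\<bar>real_of_int n\<bar> < 1" using pi_gt_zero by (simp only: mult_less_cancel_left_pos)
  then have "n = 0" by linarith
  then show ?thesis using n by simp
qed

text \<open>On a line the component \<open>h\<close> along \<open>perp a\<close> determines the
  point. Both half-turns, from \<open>0\<close> to \<open>pi\<close> and from \<open>pi\<close> to
  \<open>2 * pi\<close>, sweep all values between \<open>h 0\<close> and \<open>h pi\<close>, so
  some value is taken twice, against injectivity.\<close>

lemma not_in_line:
  assumes "a \<noteq> 0"
  shows "\<exists>t. a \<bullet> c t \<noteq> b"
proof (rule ccontr)
  assume "\<not> ?thesis"
  then have line: "c t \<bullet> a = b" for t by (simp add: inner_commute)
  define h where "h t = c t \<bullet> perp a" for t
  have heq: "c x = c y" if "h x = h y" for x y
  proof -
    have "(a \<bullet> a) *\<^sub>R c x = (a \<bullet> a) *\<^sub>R c y"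
      using that by (simp only: frame_expansion[of a] line h_def)
    then show ?thesis using assms by simp
  qed
  have hc: "continuous_on A h" for A unfolding h_def by (intro continuous_intros continuous)
  have h2: "h (2 * pi) = h 0"
    using eq_iff[of "2 * pi" 0] by (simp add: h_def)
  have hpi: "h pi \<noteq> h 0" using heq[of pi 0] eq_imp_eq[of pi 0] by auto
  define v where "v = (h 0 + h pi) / 2"
  have v: "h 0 < v \<and> v < h pi \<or> h pi < v \<and> v < h 0" using hpi by (auto simp: v_def)
  obtain x where x: "0 \<le> x" "x \<le> pi" "h x = v"
    using v IVT'[of h 0 v pi, OF _ _ _ hc] IVT2'[of h pi v 0, OF _ _ _ hc] by force
  obtain y where y: "pi \<le> y" "y \<le> 2 * pi" "h y = v"
    using v h2 IVT'[of h pi v "2 * pi", OF _ _ _ hc] IVT2'[of h "2 * pi" v pi, OF _ _ _ hc] by force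
  have "x \<noteq> 0" "x \<noteq> pi" using x v by auto
  then have "x = y" using x y heq[of x y] by (intro eq_imp_eq) auto
  then show False using x y \<open>x \<noteq> pi\<close> by simp
qed

text \<open>A convex set with empty interior lies in a hyperplane, which in the plane is a line;
  \<open>not_in_line\<close> excludes this.\<close>

lemma ex_inner_ball:
  obtains q \<rho> where "\<rho> > 0" "cball q \<rho> \<subseteq> convex hull (range c)"
proof -
  have "interior (convex hull (range c)) \<noteq> {}"
  proof
    assume "interior (convex hull (range c)) = {}"
    then obtain a b where "a \<noteq> 0" "convex hull (range c) \<subseteq> {x. a \<bullet> x = b}"
      using empty_interior_subset_hyperplane convex_convex_hull by metis
    then show False using not_in_line[of a b] by (auto dest!: subsetD intro: hull_inc)
  qed
  then show ?thesis using that by (metis all_not_in_conv mem_interior_cball)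
qed

text \<open>The half plane behind the supporting line contains the convex hull, hence also the point
  of the ball lying furthest in direction \<open>\<nu>\<close>.\<close>

lemma support_inner_ball:
  assumes "cball q \<rho> \<subseteq> convex hull (range c)" "\<rho> \<ge> 0" "norm \<nu> = 1" "\<And>u. \<nu> \<bullet> (c t - c u) \<ge> 0"
  shows "\<nu> \<bullet> (c t - q) \<ge> \<rho>"
proof -
  have "range c \<subseteq> {z. \<nu> \<bullet> z \<le> \<nu> \<bullet> c t}" using assms(4) by (auto simp: inner_diff_right)
  then have "convex hull (range c) \<subseteq> {z. \<nu> \<bullet> z \<le> \<nu> \<bullet> c t}"
    by (simp add: convex_halfspace_le hull_minimal)
  moreover have "q + \<rho> *\<^sub>R \<nu> \<in> cball q \<rho>" using assms by (simp add: dist_norm)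
  ultimately have "\<nu> \<bullet> (q + \<rho> *\<^sub>R \<nu>) \<le> \<nu> \<bullet> c t" using assms(1) by blast
  moreover have "\<nu> \<bullet> \<nu> = 1" using assms(3) by (simp add: norm_eq_1)
  ultimately show ?thesis by (simp add: inner_add_right inner_diff_right)
qed

text \<open>The function \<open>c u \<bullet> \<nu>\<close> is maximal at \<open>u = t\<close>, so
  \<open>\<nu>\<close> is orthogonal to the tangent. In the plane this leaves two unit
  vectors.\<close>

lemma support_eq_perp_tangent:
  assumes t: "unit_speed_at c t" and \<nu>: "norm \<nu> = 1" "\<And>u. \<nu> \<bullet> (c t - c u) \<ge> 0"
  shows "\<nu> = perp (tangent t) \<or> \<nu> = - perp (tangent t)"
proof -
  have "\<nu> \<bullet> tangent t = 0"
  proof -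
    have "((\<lambda>u. c u \<bullet> \<nu>) has_real_derivative tangent t \<bullet> \<nu>) (at t)"
      by (rule has_real_derivative_inner[OF t])
    moreover have "\<forall>y. \<bar>t - y\<bar> < 1 \<longrightarrow> c y \<bullet> \<nu> \<le> c t \<bullet> \<nu>"
      using \<nu>(2) by (simp add: inner_diff_right inner_commute)
    ultimately show ?thesis using DERIV_local_max[of "\<lambda>u. c u \<bullet> \<nu>" _ t 1] by (simp add: inner_commute)
  qed
  moreover have "tangent t \<bullet> tangent t = 1" using t by (simp add: unit_speed_at_def norm_eq_1)
  ultimately have eq: "\<nu> = (\<nu> \<bullet> perp (tangent t)) *\<^sub>R perp (tangent t)"
    using frame_expansion[of "tangent t" \<nu>] by simp
  then have "\<bar>\<nu> \<bullet> perp (tangent t)\<bar> = 1"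
    using \<nu>(1) t by (metis mult.right_neutral norm_perp norm_scaleR unit_speed_at_def)
  then have "\<nu> \<bullet> perp (tangent t) = 1 \<or> \<nu> \<bullet> perp (tangent t) = -1" by linarith
  then show ?thesis using eq by (metis scaleR_minus1_left scaleR_one)
qed

lemma perp_tangent_supports:
  assumes "unit_speed_at c t"
  shows "(\<forall>u. perp (tangent t) \<bullet> (c t - c u) \<ge> 0) \<or> (\<forall>u. (- perp (tangent t)) \<bullet> (c t - c u) \<ge> 0)"
  using support[of t] support_eq_perp_tangent[OF assms] by metis

section \<open>Local injectivity and constancy of the orientation\<close>

lemma support_near:
  assumes ball: "cball q \<rho> \<subseteq> convex hull (range c)" and \<rho>: "\<rho> > 0"
  obtains \<delta> where "\<delta> > 0"
    "\<And>t \<nu>. \<lbrakk>\<bar>t - t0\<bar> < \<delta>; norm \<nu> = 1; \<And>u. \<nu> \<bullet> (c t - c u) \<ge> 0\<rbrakk> \<Longrightarrow> \<nu> \<bullet> (c t0 - q) \<ge> \<rho> / 2"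
proof -
  have L: "L \<ge> 0" using lipschitz by (rule lipschitz_on_nonneg)
  \<comment> \<open>Replacing \<open>c t\<close> by \<open>c t0\<close> costs at most
    \<open>L * \<delta>\<close>, hence at most \<open>\<rho> / 2\<close>. The summand
    \<open>1\<close> keeps the denominator positive when \<open>L = 0\<close>.\<close>
  define \<delta> where "\<delta> = \<rho> / (2 * (L + 1))"
  have "\<nu> \<bullet> (c t0 - q) \<ge> \<rho> / 2"
    if "\<bar>t - t0\<bar> < \<delta>" "norm \<nu> = 1" "\<And>u. \<nu> \<bullet> (c t - c u) \<ge> 0" for t \<nu>
  proof -
    have "\<nu> \<bullet> (c t - c t0) \<le> norm \<nu> * norm (c t - c t0)" by (rule norm_cauchy_schwarz)
    also have "\<dots> \<le> L * \<bar>t - t0\<bar>" using norm_diff_le that by simp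
    also have "\<dots> \<le> (L + 1) * \<delta>" using that L by (intro mult_mono) auto
    also have "\<dots> = \<rho> / 2" using L by (simp add: \<delta>_def field_simps add_nonneg_eq_0_iff)
    finally show ?thesis
      using support_inner_ball[OF ball _ that(2,3)] \<rho> by (simp add: inner_diff_right)
  qed
  moreover have "\<delta> > 0" using L \<rho> by (simp add: \<delta>_def)
  ultimately show ?thesis using that by blast
qed

text \<open>
  Two nearby points of the curve with the same component along \<open>perp (c t0 - q)\<close> differ by a
  multiple of \<open>c t0 - q\<close>, so the one closer to \<open>q\<close> cannot have a supporting line.
\<close>

lemma inj_component_near:
  assumes ball: "cball q \<rho> \<subseteq> convex hull (range c)" and \<rho>: "\<rho> > 0"
  obtains \<delta> where "\<delta> > 0" "inj_on (\<lambda>t. c t \<bullet> perp (c t0 - q)) {t0 - \<delta><..<t0 + \<delta>}"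
proof -
  define f where "f = c t0 - q"
  obtain \<delta>1 where \<delta>1: "\<delta>1 > 0"
    "\<And>t \<nu>. \<lbrakk>\<bar>t - t0\<bar> < \<delta>1; norm \<nu> = 1; \<And>u. \<nu> \<bullet> (c t - c u) \<ge> 0\<rbrakk> \<Longrightarrow> \<nu> \<bullet> f \<ge> \<rho> / 2"
    using support_near[OF ball \<rho>] unfolding f_def by metis
  have f0: "f \<noteq> 0" using \<delta>1(2)[of t0] \<delta>1(1) support[of t0] \<rho> by force
  have le: "c x \<bullet> f \<le> c y \<bullet> f"
    if xy: "\<bar>y - t0\<bar> < \<delta>1" "c x \<bullet> perp f = c y \<bullet> perp f" for x y
  proof (rule ccontr)
    assume contr: "\<not> c x \<bullet> f \<le> c y \<bullet> f"
    obtain \<nu> where \<nu>: "norm \<nu> = 1" "\<And>u. \<nu> \<bullet> (c y - c u) \<ge> 0" using support by blast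
    have "(f \<bullet> f) * ((c y - c x) \<bullet> \<nu>) = ((c y - c x) \<bullet> f) * (\<nu> \<bullet> f)"
      using inner_frame_expansion[of f "c y - c x" \<nu>] xy(2) by (simp add: inner_diff_left)
    moreover have "\<dots> < 0"
      using contr \<delta>1(2)[OF xy(1) \<nu>] \<rho> by (intro mult_neg_pos) (auto simp: inner_diff_left)
    moreover have "(f \<bullet> f) * ((c y - c x) \<bullet> \<nu>) \<ge> 0"
      using \<nu>(2)[of x] by (simp add: inner_commute)
    ultimately show False by simp
  qed
  \<comment> \<open>The bound \<open>pi\<close> makes any two parameters in the interval differ by
    less than \<open>2 * pi\<close>, as \<open>eq_imp_eq\<close> requires.\<close>
  have "inj_on (\<lambda>t. c t \<bullet> perp f) {t0 - min \<delta>1 pi<..<t0 + min \<delta>1 pi}"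
  proof (rule inj_onI)
    fix x y assume xy: "x \<in> {t0 - min \<delta>1 pi<..<t0 + min \<delta>1 pi}" "y \<in> {t0 - min \<delta>1 pi<..<t0 + min \<delta>1 pi}"
      "c x \<bullet> perp f = c y \<bullet> perp f"
    then have "c x \<bullet> f = c y \<bullet> f"
      using le[of x y] le[of y x] by (auto intro!: antisym)
    then have "(f \<bullet> f) *\<^sub>R c x = (f \<bullet> f) *\<^sub>R c y"
      using xy(3) by (simp only: frame_expansion[of f])
    then have "c x = c y" using f0 by simp
    then show "x = y" using xy by (intro eq_imp_eq) auto
  qed
  then show ?thesis using that[of "min \<delta>1 pi"] \<delta>1(1) by (simp add: f_def)
qed

text \<open>Near \<open>t0\<close> the component \<open>h\<close> along \<open>perp f\<close> is
  continuous and injective, hence strictly monotone. Its derivative has the sign opposite to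
  \<open>perp (tangent t) \<bullet> f\<close>, and that sign tells on which side of the tangent line
  the curve lies. Opposite sides at \<open>x\<close> and \<open>y\<close> would make
  \<open>h\<close> rise somewhere and fall elsewhere.\<close>

lemma locally_oriented:
  obtains \<delta> where "\<delta> > 0"
    "\<And>x y u v. \<lbrakk>\<bar>x - t0\<bar> < \<delta>; \<bar>y - t0\<bar> < \<delta>; unit_speed_at c x; unit_speed_at c y;
       \<And>u. perp (tangent x) \<bullet> (c x - c u) \<ge> 0\<rbrakk> \<Longrightarrow> perp (tangent y) \<bullet> (c y - c v) \<ge> 0"
proof -
  obtain q \<rho> where \<rho>: "\<rho> > 0" and ball: "cball q \<rho> \<subseteq> convex hull (range c)"
    by (rule ex_inner_ball)
  define f where "f = c t0 - q"
  obtain \<delta>1 where \<delta>1: "\<delta>1 > 0"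
    "\<And>t \<nu>. \<lbrakk>\<bar>t - t0\<bar> < \<delta>1; norm \<nu> = 1; \<And>u. \<nu> \<bullet> (c t - c u) \<ge> 0\<rbrakk> \<Longrightarrow> \<nu> \<bullet> f \<ge> \<rho> / 2"
    using support_near[OF ball \<rho>] unfolding f_def by metis
  define h where "h t = c t \<bullet> perp f" for t
  obtain \<delta>2 where \<delta>2: "\<delta>2 > 0" "inj_on h {t0 - \<delta>2<..<t0 + \<delta>2}"
    unfolding h_def f_def by (rule inj_component_near[OF ball \<rho>])
  define I where "I = {t0 - \<delta>2<..<t0 + \<delta>2}"
  have "continuous_on I h" unfolding h_def by (intro continuous_intros continuous)
  then have mono: "strict_mono_on I h \<or> strict_antimono_on I h"
    using injective_eq_monotone_map[of I h] \<delta>2(2) by (simp add: I_def)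
  have deriv: "(h has_real_derivative - (perp (tangent t) \<bullet> f)) (at t)" if "unit_speed_at c t" for t
    using has_real_derivative_inner[OF that, of "perp f"] unfolding h_def by (simp add: inner_perp_left)
  have up: "\<exists>y\<in>I. y > t \<and> h t < h y" if t: "unit_speed_at c t" "perp (tangent t) \<bullet> f < 0" "t \<in> I" for t
  proof -
    obtain d where d: "d > 0" "\<And>k. 0 < k \<Longrightarrow> k < d \<Longrightarrow> h t < h (t + k)"
      using DERIV_pos_inc_right[OF deriv[OF t(1)]] t(2) by auto
    define k where "k = min d (t0 + \<delta>2 - t) / 2"
    have "0 < k" "k \<le> d / 2" "k \<le> (t0 + \<delta>2 - t) / 2"
      using d(1) t(3) by (simp_all add: k_def I_def)
    then have "0 < k" "k < d" "t + k \<in> I" using d(1) t(3) by (auto simp: I_def)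
    then show ?thesis using d(2) by (intro bexI[of _ "t + k"]) auto
  qed
  have down: "\<exists>y\<in>I. y > t \<and> h y < h t" if t: "unit_speed_at c t" "perp (tangent t) \<bullet> f > 0" "t \<in> I" for t
  proof -
    obtain d where d: "d > 0" "\<And>k. 0 < k \<Longrightarrow> k < d \<Longrightarrow> h (t + k) < h t"
      using DERIV_neg_dec_right[OF deriv[OF t(1)]] t(2) by auto
    define k where "k = min d (t0 + \<delta>2 - t) / 2"
    have "0 < k" "k \<le> d / 2" "k \<le> (t0 + \<delta>2 - t) / 2"
      using d(1) t(3) by (simp_all add: k_def I_def)
    then have "0 < k" "k < d" "t + k \<in> I" using d(1) t(3) by (auto simp: I_def)
    then show ?thesis using d(2) by (intro bexI[of _ "t + k"]) auto
  qed
  have key: "perp (tangent y) \<bullet> (c y - c v) \<ge> 0"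
    if xy: "\<bar>x - t0\<bar> < min \<delta>1 \<delta>2" "\<bar>y - t0\<bar> < min \<delta>1 \<delta>2" "unit_speed_at c x" "unit_speed_at c y"
      "\<And>u. perp (tangent x) \<bullet> (c x - c u) \<ge> 0" for x y v
  proof (rule ccontr)
    assume "\<not> ?thesis"
    then have "\<And>u. (- perp (tangent y)) \<bullet> (c y - c u) \<ge> 0"
      using perp_tangent_supports[OF xy(4)] by blast
    then have "perp (tangent y) \<bullet> f < 0"
      using \<delta>1(2)[of y "- perp (tangent y)"] xy \<rho> by (simp add: unit_speed_at_def)
    moreover have "perp (tangent x) \<bullet> f > 0"
      using \<delta>1(2)[of x "perp (tangent x)"] xy \<rho> by (simp add: unit_speed_at_def)
    moreover have "x \<in> I" "y \<in> I" using xy by (auto simp: I_def)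
    ultimately show False
      using up[of y] down[of x] xy mono by (meson less_asym monotone_onD)
  qed
  have "min \<delta>1 \<delta>2 > 0" using \<delta>1(1) \<delta>2(1) by simp
  then show ?thesis by (rule that) (rule key)
qed

text \<open>Among points of unit speed, which are dense, the side is locally constant by
  \<open>locally_oriented\<close>; connectedness of the real line makes it globally
  constant.\<close>

lemma ex_orientation:
  obtains \<epsilon> :: real where "\<epsilon> = 1 \<or> \<epsilon> = -1"
    "\<And>t u. unit_speed_at c t \<Longrightarrow> \<epsilon> * (perp (tangent t) \<bullet> (c t - c u)) \<ge> 0"
proof -
  define P where "P t \<longleftrightarrow> (\<forall>u. perp (tangent t) \<bullet> (c t - c u) \<ge> 0)" for t
  have const: "P x \<longleftrightarrow> P y" if "unit_speed_at c x" "unit_speed_at c y" for x y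
  proof (rule connected_equivalence_relation_gen[where S = "UNIV :: real set" and P = "unit_speed_at c"])
    fix T :: "real set" and a assume "openin (top_of_set UNIV) T" "a \<in> T"
    then obtain e where "e > 0" "ball a e \<subseteq> T" by (metis open_openin openE subtopology_UNIV)
    moreover obtain z where "a < z" "z < a + e" "unit_speed_at c z"
      using ex_unit_speed_between[of a "a + e"] \<open>e > 0\<close> by auto
    ultimately show "\<exists>z. z \<in> T \<and> unit_speed_at c z"
      by (intro exI[of _ z]) (auto simp: dist_real_def subset_iff)
  next
    fix a :: real
    obtain \<delta> where "\<delta> > 0" and
      *: "\<And>x y u v. \<lbrakk>\<bar>x - a\<bar> < \<delta>; \<bar>y - a\<bar> < \<delta>; unit_speed_at c x; unit_speed_at c y;
         \<And>u. perp (tangent x) \<bullet> (c x - c u) \<ge> 0\<rbrakk> \<Longrightarrow> perp (tangent y) \<bullet> (c y - c v) \<ge> 0"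
      by (rule locally_oriented[of a]) blast
    have imp: "P y"
      if "x \<in> ball a \<delta>" "y \<in> ball a \<delta>" "unit_speed_at c x" "unit_speed_at c y" "P x" for x y
      unfolding P_def
    proof
      fix v
      show "perp (tangent y) \<bullet> (c y - c v) \<ge> 0"
        by (rule *[of x y]) (use that in \<open>auto simp: dist_real_def abs_minus_commute P_def\<close>)
    qed
    have "\<forall>x\<in>ball a \<delta>. \<forall>y\<in>ball a \<delta>. unit_speed_at c x \<and> unit_speed_at c y \<longrightarrow> P x = P y"
      using imp by blast
    moreover have "openin (top_of_set UNIV) (ball a \<delta>)" "a \<in> ball a \<delta>"
      using \<open>\<delta> > 0\<close> by simp_all
    ultimately show "\<exists>T. openin (top_of_set UNIV) T \<and> a \<in> T \<and>
        (\<forall>x\<in>T. \<forall>y\<in>T. unit_speed_at c x \<and> unit_speed_at c y \<longrightarrow> P x = P y)"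
      by blast
  qed (use that in auto)
  obtain t where t: "unit_speed_at c t" using ex_unit_speed_between[of 0 1] by auto
  show ?thesis
  proof (cases "P t")
    case True
    then show ?thesis using that[of 1] const[OF t] P_def by auto
  next
    case False
    have "(- perp (tangent x)) \<bullet> (c x - c u) \<ge> 0" if "unit_speed_at c x" for x u
      using perp_tangent_supports[OF that] const[OF t that] False P_def by metis
    then show ?thesis using that[of "-1"] by simp
  qed
qed

end

subsection \<open>Corners and strict differentiability\<close>

text \<open>The sign \<open>\<epsilon>\<close> fixes the sense in which the loop is traversed, so
  that the rotated tangent is an outward normal up to one global sign.\<close>

locale oriented_convex_loop = convex_loop +
  fixes \<epsilon> :: real
  assumes orientation: "\<epsilon> = 1 \<or> \<epsilon> = -1"
    and outward: "unit_speed_at c t \<Longrightarrow> \<epsilon> * (perp (tangent t) \<bullet> (c t - c u)) \<ge> 0"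
begin

abbreviation outer_normal :: "real \<Rightarrow> real^2" where
  "outer_normal t \<equiv> \<epsilon> *\<^sub>R perp (tangent t)"

lemma orientation_square [simp]: "\<epsilon> * \<epsilon> = 1" "\<epsilon> * (\<epsilon> * a) = a"
  using orientation by auto

lemma outer_normal_supports:
  "unit_speed_at c t \<Longrightarrow> outer_normal t \<bullet> (c t - c u) \<ge> 0"
  using outward by simp

lemma norm_outer_normal:
  "unit_speed_at c t \<Longrightarrow> norm (outer_normal t) = 1"
  using orientation by (auto simp: unit_speed_at_def)

text \<open>A corner in the form the energy needs: the tangent line at a later point
  \<open>c y\<close> keeps a distance from the earlier point \<open>c x\<close> that is at least
  proportional to \<open>t0 - x\<close>, uniformly in \<open>y\<close>.\<close>

definition corner_at :: "real \<Rightarrow> bool" where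
  "corner_at t0 \<longleftrightarrow> (\<exists>K>0. \<exists>\<delta>>0. \<forall>x y. t0 - \<delta> < x \<longrightarrow> x < t0 \<longrightarrow> t0 < y \<longrightarrow> y < t0 + \<delta> \<longrightarrow>
     unit_speed_at c y \<longrightarrow> K * (t0 - x) \<le> outer_normal y \<bullet> (c y - c x))"

end

text \<open>
  In the orthogonal frame \<open>(e, f)\<close>, with \<open>e\<close> defined below, the curve is near \<open>t0\<close> a graph over
  the \<open>e\<close> axis; \<open>slope\<close> is the negative of its slope.
\<close>

locale local_graph = oriented_convex_loop +
  fixes t0 \<kappa> \<delta> :: real and f :: "real^2"
  assumes \<kappa>: "\<kappa> > 0" and \<delta>: "\<delta> > 0"
    and normal_ge: "\<lbrakk>\<bar>y - t0\<bar> < \<delta>; unit_speed_at c y\<rbrakk> \<Longrightarrow> outer_normal y \<bullet> f \<ge> \<kappa>"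
begin

text \<open>The sign makes the curve advance in direction \<open>e\<close> near \<open>t0\<close>
  for either orientation.\<close>

definition e :: "real^2" where
  "e = - \<epsilon> *\<^sub>R perp f"

definition slope :: "real \<Rightarrow> real" where
  "slope y = (outer_normal y \<bullet> e) / (outer_normal y \<bullet> f)"

lemma f_nonzero: "f \<noteq> 0"
proof -
  obtain y where y: "t0 < y" "y < t0 + \<delta>" "unit_speed_at c y"
    using ex_unit_speed_between[of t0 "t0 + \<delta>"] \<delta> by auto
  then show ?thesis using normal_ge[of y] \<kappa> by auto
qed

lemma f_inner_pos: "f \<bullet> f > 0"
  using f_nonzero by simp

lemma tangent_inner_e: "tangent y \<bullet> e = outer_normal y \<bullet> f"
  by (simp add: e_def inner_perp_left)

lemma tangent_inner_f: "tangent y \<bullet> f = - (outer_normal y \<bullet> e)"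
  by (simp add: e_def)

lemma inner_expansion: "(f \<bullet> f) * (v \<bullet> w) = (v \<bullet> f) * (w \<bullet> f) + (v \<bullet> e) * (w \<bullet> e)"
  using orientation by (auto simp: inner_frame_expansion e_def)

text \<open>Factoring out the positive number \<open>outer_normal y \<bullet> f\<close> reduces the
  sign of \<open>outer_normal y \<bullet> w\<close> to that of an expression affine in
  \<open>slope y\<close>.\<close>

lemma outer_normal_inner:
  assumes "\<bar>y - t0\<bar> < \<delta>" "unit_speed_at c y"
  shows "(f \<bullet> f) * (outer_normal y \<bullet> w) = (outer_normal y \<bullet> f) * (w \<bullet> f + slope y * (w \<bullet> e))"
proof -
  define n where "n = outer_normal y"
  have "n \<bullet> f \<noteq> 0" using normal_ge[OF assms] \<kappa> unfolding n_def by linarith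
  then have "n \<bullet> e = slope y * (n \<bullet> f)" by (simp add: slope_def n_def)
  then have "(f \<bullet> f) * (n \<bullet> w) = (n \<bullet> f) * (w \<bullet> f + slope y * (w \<bullet> e))"
    unfolding inner_expansion by (simp add: algebra_simps)
  then show ?thesis by (simp only: n_def)
qed

lemma chord_e:
  assumes "t0 - \<delta> < a" "a \<le> b" "b < t0 + \<delta>"
  shows "(c b - c a) \<bullet> e \<ge> \<kappa> * (b - a)"
proof -
  \<comment> \<open>The mean value inequality is an upper bound, so it is applied in direction
    \<open>- e\<close>.\<close>
  have "(c b - c a) \<bullet> (- e) \<le> (- \<kappa>) * (b - a)"
    using lipschitz unit_speed assms(2)
  proof (rule lipschitz_inner_mean_value_le)
    fix t assume "a < t" "t < b" "t \<notin> {t. \<not> unit_speed_at c t}"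
    then show "c differentiable at t \<and> tangent t \<bullet> - e \<le> - \<kappa>"
      using normal_ge[of t] assms by (auto simp: unit_speed_at_def tangent_inner_e[simplified])
  qed
  then show ?thesis by simp
qed

text \<open>The chord \<open>w\<close> from \<open>c a\<close> to \<open>c b\<close> lies behind the
  tangent line at \<open>a\<close>, and seen from \<open>b\<close> it points outward. As
  \<open>w \<bullet> e > 0\<close>, both slopes can be compared with
  \<open>- (w \<bullet> f) / (w \<bullet> e)\<close>, which lies between them.\<close>

lemma slope_mono:
  assumes "t0 - \<delta> < a" "a \<le> b" "b < t0 + \<delta>" "unit_speed_at c a" "unit_speed_at c b"
  shows "slope a \<le> slope b"
proof (cases "a = b")
  case False
  define w where "w = c b - c a"
  have we: "w \<bullet> e > 0"
  proof -
    have "0 < \<kappa> * (b - a)" using \<kappa> False assms by simp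
    then show ?thesis using chord_e[of a b] assms unfolding w_def by linarith
  qed
  have near: "\<bar>a - t0\<bar> < \<delta>" "\<bar>b - t0\<bar> < \<delta>" using assms by auto
  have "outer_normal a \<bullet> w \<le> 0"
    using outer_normal_supports[OF assms(4), of b] by (simp add: w_def inner_diff_right)
  then have "(outer_normal a \<bullet> f) * (w \<bullet> f + slope a * (w \<bullet> e)) \<le> 0"
    using f_inner_pos by (simp only: outer_normal_inner[OF near(1) assms(4), symmetric] mult_le_0_iff) simp
  then have 1: "w \<bullet> f + slope a * (w \<bullet> e) \<le> 0"
    using normal_ge[OF near(1) assms(4)] \<kappa> by (simp only: mult_le_0_iff) linarith
  have "outer_normal b \<bullet> w \<ge> 0"
    using outer_normal_supports[OF assms(5), of a] by (simp add: w_def)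
  then have "(outer_normal b \<bullet> f) * (w \<bullet> f + slope b * (w \<bullet> e)) \<ge> 0"
    using f_inner_pos by (simp only: outer_normal_inner[OF near(2) assms(5), symmetric] zero_le_mult_iff) simp
  then have 2: "w \<bullet> f + slope b * (w \<bullet> e) \<ge> 0"
    using normal_ge[OF near(2) assms(5)] \<kappa> by (simp only: zero_le_mult_iff) linarith
  have "slope a * (w \<bullet> e) \<le> slope b * (w \<bullet> e)" using 1 2 by linarith
  then show ?thesis using we by simp
qed simp

text \<open>The outer normal is a unit vector and a positive multiple of
  \<open>f + slope y *\<^sub>R e\<close>. Rotating it back exhibits the tangent as a function of the
  slope alone, to which continuity can be applied.\<close>

lemma tangent_eq_slope:
  assumes "\<bar>y - t0\<bar> < \<delta>" "unit_speed_at c y"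
  shows "tangent y = - \<epsilon> *\<^sub>R perp (sgn (f + slope y *\<^sub>R e))"
proof -
  have pos: "outer_normal y \<bullet> f > 0" using normal_ge[OF assms] \<kappa> by linarith
  have "(f \<bullet> f) *\<^sub>R outer_normal y = (outer_normal y \<bullet> f) *\<^sub>R (f + slope y *\<^sub>R e)"
  proof (rule vector_eq_rdot[THEN iffD1], rule allI)
    fix z
    show "((f \<bullet> f) *\<^sub>R outer_normal y) \<bullet> z = ((outer_normal y \<bullet> f) *\<^sub>R (f + slope y *\<^sub>R e)) \<bullet> z"
      using outer_normal_inner[OF assms, of z] by (simp add: inner_add_left inner_add_right inner_commute)
  qed
  then have "sgn ((f \<bullet> f) *\<^sub>R outer_normal y) = sgn ((outer_normal y \<bullet> f) *\<^sub>R (f + slope y *\<^sub>R e))"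
    by (rule arg_cong)
  then have "sgn (outer_normal y) = sgn (f + slope y *\<^sub>R e)"
    unfolding sgn_scaleR sgn_pos[OF pos] sgn_pos[OF f_inner_pos] by (simp only: scaleR_one)
  then have "outer_normal y = sgn (f + slope y *\<^sub>R e)"
    by (simp only: sgn_div_norm[of "outer_normal y"] norm_outer_normal[OF assms(2)] inverse_1 scaleR_one)
  moreover have "tangent y = - \<epsilon> *\<^sub>R perp (outer_normal y)"
    by (simp add: linear_cmul[OF linear_perp])
  ultimately show ?thesis by simp
qed

section \<open>One-sided slopes at \<open>t0\<close>: jump or no jump\<close>

definition left_slopes :: "real set" where
  "left_slopes = slope ` {y. t0 - \<delta> < y \<and> y < t0 \<and> unit_speed_at c y}"

definition right_slopes :: "real set" where
  "right_slopes = slope ` {y. t0 < y \<and> y < t0 + \<delta> \<and> unit_speed_at c y}"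

lemma slopes_le: "a \<in> left_slopes \<Longrightarrow> b \<in> right_slopes \<Longrightarrow> a \<le> b"
  unfolding left_slopes_def right_slopes_def using \<delta> by (auto intro!: slope_mono)

lemma left_slopes_nonempty: "left_slopes \<noteq> {}"
  unfolding left_slopes_def using ex_unit_speed_between[of "t0 - \<delta>" t0] \<delta> by auto

lemma right_slopes_nonempty: "right_slopes \<noteq> {}"
  unfolding right_slopes_def using ex_unit_speed_between[of t0 "t0 + \<delta>"] \<delta> by auto

lemma bdd_slopes: "bdd_above left_slopes" "bdd_below right_slopes"
  using slopes_le left_slopes_nonempty right_slopes_nonempty
  by (meson bdd_aboveI all_not_in_conv, meson bdd_belowI all_not_in_conv)

text \<open>On the arc from \<open>c x\<close> to \<open>c t0\<close> the values of
  \<open>slope\<close> are at most \<open>a\<close>, at \<open>y\<close> the value is at least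
  \<open>b\<close>. The gap \<open>b - a\<close> turns the extent of the chord along
  \<open>e\<close> into distance from the tangent line at \<open>y\<close>.\<close>

lemma corner_if_slope_jump:
  assumes jump: "Sup left_slopes < Inf right_slopes"
  shows "corner_at t0"
proof -
  define a where "a = Sup left_slopes"
  define b where "b = Inf right_slopes"
  \<comment> \<open>One factor \<open>\<kappa>\<close> comes from \<open>chord_e\<close>, the other
    from the lower bound on \<open>outer_normal y \<bullet> f\<close>; the division by
    \<open>f \<bullet> f\<close> is due to the frame not being normalised.\<close>
  define K where "K = \<kappa> * ((b - a) * \<kappa>) / (f \<bullet> f)"
  have "K > 0" using jump \<kappa> f_inner_pos by (simp add: K_def a_def b_def)
  have "K * (t0 - x) \<le> outer_normal y \<bullet> (c y - c x)"
    if x: "t0 - \<delta> < x" "x < t0" and y: "t0 < y" "y < t0 + \<delta>" "unit_speed_at c y" for x y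
  proof -
    define w where "w = c t0 - c x"
    have near: "\<bar>y - t0\<bar> < \<delta>" using y by simp
    have "w \<bullet> (- (f + a *\<^sub>R e)) \<le> 0 * (t0 - x)"
      unfolding w_def using lipschitz unit_speed
    proof (rule lipschitz_inner_mean_value_le)
      show "x \<le> t0" using x by simp
      fix t assume t: "x < t" "t < t0" "t \<notin> {t. \<not> unit_speed_at c t}"
      then have reg: "unit_speed_at c t" and near': "\<bar>t - t0\<bar> < \<delta>" using x by auto
      have pos: "outer_normal t \<bullet> f > 0" using normal_ge[OF near' reg] \<kappa> by linarith
      have "slope t \<in> left_slopes" unfolding left_slopes_def using t x by auto
      then have "slope t \<le> a" unfolding a_def by (rule cSup_upper[OF _ bdd_slopes(1)])
      then have "outer_normal t \<bullet> e \<le> a * (outer_normal t \<bullet> f)"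
        using pos by (simp only: slope_def pos_divide_le_eq)
      then have "tangent t \<bullet> - (f + a *\<^sub>R e) \<le> 0"
        using tangent_inner_e[of t] tangent_inner_f[of t]
        by (simp only: inner_minus_right inner_add_right inner_scaleR_right)
      then show "c differentiable at t \<and> tangent t \<bullet> - (f + a *\<^sub>R e) \<le> 0"
        using reg by (simp add: unit_speed_at_def)
    qed
    then have wf: "w \<bullet> f + a * (w \<bullet> e) \<ge> 0" by (simp add: inner_diff_right)
    have we: "w \<bullet> e \<ge> \<kappa> * (t0 - x)" using chord_e[of x t0] x \<delta> by (simp add: w_def)
    have "slope y \<in> right_slopes" unfolding right_slopes_def using y by auto
    then have sy: "b \<le> slope y" unfolding b_def by (rule cInf_lower[OF _ bdd_slopes(2)])
    have "(b - a) * (\<kappa> * (t0 - x)) \<le> (slope y - a) * (w \<bullet> e)"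
      using sy we jump \<kappa> x by (intro mult_mono) (auto simp: a_def b_def)
    also have "\<dots> \<le> w \<bullet> f + slope y * (w \<bullet> e)" using wf by (simp add: algebra_simps)
    finally have *: "(b - a) * (\<kappa> * (t0 - x)) \<le> w \<bullet> f + slope y * (w \<bullet> e)" .
    have "(b - a) * (\<kappa> * (t0 - x)) \<ge> 0" using jump \<kappa> x by (simp add: a_def b_def)
    then have "\<kappa> * ((b - a) * (\<kappa> * (t0 - x))) \<le> (outer_normal y \<bullet> f) * (w \<bullet> f + slope y * (w \<bullet> e))"
      using * normal_ge[OF near y(3)] \<kappa> by (intro mult_mono) auto
    also have "\<dots> = (f \<bullet> f) * (outer_normal y \<bullet> w)" by (rule outer_normal_inner[OF near y(3), symmetric])
    finally have "K * (t0 - x) \<le> outer_normal y \<bullet> w"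
      using f_inner_pos by (simp add: K_def field_simps)
    \<comment> \<open>The tangent line at \<open>y\<close> supports the curve, so the remaining
      chord from \<open>c t0\<close> to \<open>c y\<close> contributes a nonnegative amount.\<close>
    also have "\<dots> \<le> outer_normal y \<bullet> w + outer_normal y \<bullet> (c y - c t0)"
      using outer_normal_supports[OF y(3), of t0] by linarith
    also have "\<dots> = outer_normal y \<bullet> (c y - c x)"
      by (simp only: inner_add_right[symmetric] w_def) simp
    finally show ?thesis .
  qed
  then show ?thesis unfolding corner_at_def using \<open>K > 0\<close> \<delta> by blast
qed

text \<open>Without a jump, monotonicity traps all slopes near \<open>t0\<close> close to
  \<open>a\<close>. The tangent is a function \<open>g\<close> of the slope, continuous at
  \<open>a\<close>, so nearby tangents are close to \<open>g a\<close>, and the mean value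
  inequality carries this over to chords.\<close>

lemma strictly_differentiable_if_no_slope_jump:
  assumes no_jump: "\<not> Sup left_slopes < Inf right_slopes"
  shows "\<exists>d. strictly_differentiable_at c d t0"
proof -
  define a where "a = Sup left_slopes"
  have "Sup left_slopes \<le> Inf right_slopes"
    using slopes_le left_slopes_nonempty right_slopes_nonempty
    by (intro cSup_least cInf_greatest) auto
  then have aR: "a = Inf right_slopes" using no_jump by (simp add: a_def)
  define g where "g m = - \<epsilon> *\<^sub>R perp (sgn (f + m *\<^sub>R e))" for m
  \<comment> \<open>As \<open>e\<close> is orthogonal to \<open>f\<close>, this inner product equals
    \<open>f \<bullet> f\<close>. The vector is thus nonzero, where \<open>sgn\<close> is
    continuous.\<close>
  have "(f + a *\<^sub>R e) \<bullet> f \<noteq> 0" using f_nonzero by (simp add: e_def inner_add_left inner_diff_left)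
  then have "f + a *\<^sub>R e \<noteq> 0" by auto
  then have sgn_cont: "isCont (\<lambda>m. sgn (f + m *\<^sub>R e)) a"
    by (intro continuous_sgn continuous_intros) auto
  have cont: "isCont g a"
    unfolding g_def
    by (intro continuous_scaleR continuous_const sgn_cont
        bounded_linear.continuous[OF linear_conv_bounded_linear[THEN iffD1, OF linear_perp]])
  have "strictly_differentiable_at c (g a) t0"
    unfolding strictly_differentiable_at_def
  proof (intro allI impI)
    fix \<eta> :: real assume "\<eta> > 0"
    then obtain s where s: "s > 0" "\<And>m. \<bar>m - a\<bar> < s \<Longrightarrow> norm (g m - g a) < \<eta>"
      using cont unfolding continuous_at_eps_delta by (auto simp: dist_norm)
    obtain y1 where y1: "t0 - \<delta> < y1" "y1 < t0" "unit_speed_at c y1" "a - s < slope y1"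
      using less_cSupD[OF left_slopes_nonempty, of "a - s"] s(1)
      by (auto simp: a_def left_slopes_def)
    obtain y2 where y2: "t0 < y2" "y2 < t0 + \<delta>" "unit_speed_at c y2" "slope y2 < a + s"
      using cInf_lessD[OF right_slopes_nonempty, of "a + s"] s(1)
      by (auto simp: aR right_slopes_def)
    have *: "norm (c y - c x - (y - x) *\<^sub>R g a) \<le> \<eta> * (y - x)"
      if "y1 < x" "y < y2" "x \<le> y" for x y
      using lipschitz unit_speed that(3)
    proof (rule lipschitz_norm_mean_value_le)
      fix t assume t: "x < t" "t < y" "t \<notin> {t. \<not> unit_speed_at c t}"
      then have reg: "unit_speed_at c t" by simp
      have "slope y1 \<le> slope t" "slope t \<le> slope y2"
        using y1 y2 t reg that by (auto intro!: slope_mono)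
      then have "norm (g (slope t) - g a) < \<eta>" using y1 y2 by (intro s(2)) auto
      moreover have "tangent t = g (slope t)"
        unfolding g_def using t that y1 y2 by (intro tangent_eq_slope reg) auto
      ultimately show "c differentiable at t \<and> norm (tangent t - g a) \<le> \<eta>"
        using reg by (simp add: unit_speed_at_def)
    qed
    define r where "r = min (t0 - y1) (y2 - t0)"
    have "norm (c y - c x - (y - x) *\<^sub>R g a) \<le> \<eta> * \<bar>y - x\<bar>"
      if "\<bar>x - t0\<bar> < r" "\<bar>y - t0\<bar> < r" for x y
    proof (cases "x \<le> y")
      case True
      then show ?thesis using *[of x y] that by (auto simp: r_def)
    next
      case False
      have "c y - c x - (y - x) *\<^sub>R g a = - (c x - c y - (x - y) *\<^sub>R g a)"
        by (simp add: algebra_simps)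
      then show ?thesis
        using *[of y x] that False by (simp only: norm_minus_cancel) (auto simp: r_def)
    qed
    then show "\<exists>\<delta>>0. \<forall>x y. \<bar>x - t0\<bar> < \<delta> \<longrightarrow> \<bar>y - t0\<bar> < \<delta> \<longrightarrow>
        norm (c y - c x - (y - x) *\<^sub>R g a) \<le> \<eta> * \<bar>y - x\<bar>"
      using y1 y2 by (intro exI[of _ r]) (simp add: r_def)
  qed
  then show ?thesis by blast
qed

end

context oriented_convex_loop
begin

text \<open>If \<open>q\<close> is the centre of a disc inside the convex hull, every outer normal
  near \<open>t0\<close> has inner product at least \<open>\<rho> / 2\<close> with
  \<open>c t0 - q\<close>; this vector can serve as the axis \<open>f\<close> of the local
  graph.\<close>

lemma strictly_differentiable_or_corner:
  "(\<exists>d. strictly_differentiable_at c d t0) \<or> corner_at t0"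
proof -
  obtain q \<rho> where \<rho>: "\<rho> > 0" and ball: "cball q \<rho> \<subseteq> convex hull (range c)"
    by (rule ex_inner_ball)
  obtain \<delta> where \<delta>: "\<delta> > 0"
    "\<And>t \<nu>. \<lbrakk>\<bar>t - t0\<bar> < \<delta>; norm \<nu> = 1; \<And>u. \<nu> \<bullet> (c t - c u) \<ge> 0\<rbrakk> \<Longrightarrow> \<nu> \<bullet> (c t0 - q) \<ge> \<rho> / 2"
    using support_near[OF ball \<rho>] by metis
  interpret local_graph c L \<epsilon> t0 "\<rho> / 2" \<delta> "c t0 - q"
  proof unfold_locales
    fix y assume "\<bar>y - t0\<bar> < \<delta>" "unit_speed_at c y"
    then show "\<rho> / 2 \<le> outer_normal y \<bullet> (c t0 - q)"
      by (intro \<delta>(2)[of y] norm_outer_normal outer_normal_supports)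
  qed (use \<delta>(1) \<rho> in auto)
  show ?thesis
    using corner_if_slope_jump strictly_differentiable_if_no_slope_jump by blast
qed

end

subsection \<open>The energy of a curve with a corner\<close>

text \<open>For a constant sign one of the two parts integrates to zero, so the difference in
  \<open>ext_integral\<close> is never \<open>\<infinity> - \<infinity>\<close>.\<close>

lemma e2ennreal_abs_ext_integral:
  assumes \<epsilon>: "\<epsilon> = 1 \<or> \<epsilon> = -1" and nonneg: "AE x in M. \<epsilon> * f x \<ge> 0"
  shows "e2ennreal \<bar>ext_integral M f\<bar> = (\<integral>\<^sup>+x. ennreal (\<epsilon> * f x) \<partial>M)"
  using \<epsilon>
proof
  assume [simp]: "\<epsilon> = 1"
  have "(\<integral>\<^sup>+x. ennreal (- f x) \<partial>M) = (\<integral>\<^sup>+x. 0 \<partial>M)"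
    using nonneg by (intro nn_integral_cong_AE) (auto simp: ennreal_neg)
  then show ?thesis by (simp add: ext_integral_def zero_ennreal.rep_eq)
next
  assume [simp]: "\<epsilon> = -1"
  have "(\<integral>\<^sup>+x. ennreal (f x) \<partial>M) = (\<integral>\<^sup>+x. 0 \<partial>M)"
    using nonneg by (intro nn_integral_cong_AE) (auto simp: ennreal_neg)
  then show ?thesis by (simp add: ext_integral_def zero_ennreal.rep_eq)
qed

lemma ennreal_powr_mono:
  assumes "a \<le> b" "p \<ge> 0"
  shows "ennreal_powr a p \<le> ennreal_powr b p"
  using assms
  by (cases a; cases b) (auto simp: ennreal_powr_def top_unique intro!: ennreal_leI powr_mono2)

lemma ennreal_powr_ennreal: "z \<ge> 0 \<Longrightarrow> ennreal_powr (ennreal z) p = ennreal (z powr p)"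
  by (simp add: ennreal_powr_def)

text \<open>The antiderivative \<open>- C * ln (t - x)\<close> is unbounded near \<open>t\<close>,
  so compact subintervals already yield every finite amount.\<close>

lemma nn_integral_inverse_distance:
  assumes "r > 0" "C > 0"
  shows "(\<integral>\<^sup>+x. ennreal (C / (t - x)) * indicator {t - r<..<t} x \<partial>lborel) = \<infinity>"
proof -
  define I where "I = (\<integral>\<^sup>+x. ennreal (C / (t - x)) * indicator {t - r<..<t} x \<partial>lborel)"
  have ge: "ennreal B \<le> I" if "B \<ge> 0" for B
  proof -
    define a where "a = t - r / 2"
    \<comment> \<open>Solves \<open>F b - F a = B\<close>, so that the integral over
      \<open>{a..b}\<close> is exactly the prescribed \<open>B\<close>.\<close>
    define b where "b = t - r / 2 * exp (- B / C)"
    have ab: "t - r < a" "a \<le> b" "b < t" using assms that by (auto simp: a_def b_def divide_le_0_iff)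
    define F where "F x = - C * ln (t - x)" for x
    have "(\<integral>\<^sup>+x. ennreal (C * inverse \<bar>t - x\<bar>) * indicator {a..b} x \<partial>lborel) = F b - F a"
    proof (rule nn_integral_FTC_Icc)
      show "a \<le> b" by fact
      fix x assume "x \<in> {a..b}"
      then have "x < t" using ab by simp
      then show "DERIV F x :> C * inverse \<bar>t - x\<bar>"
        unfolding F_def by (auto intro!: derivative_eq_intros simp: field_simps)
      show "C * inverse \<bar>t - x\<bar> \<ge> 0" using assms by simp
    qed measurable
    moreover have "F b - F a = B"
    proof -
      have "ln (r / 2 * exp (- B / C)) = ln (r / 2) - B / C"
        using assms ln_mult[of "r / 2" "exp (- B / C)"] by (simp only: ln_exp) simp
      then have "F b = - C * (ln (r / 2) - B / C)" "F a = - C * ln (r / 2)"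
        by (simp_all only: F_def a_def b_def diff_diff_eq2 add_diff_cancel_left')
      then show ?thesis using assms by (simp add: algebra_simps)
    qed
    ultimately have "ennreal B = (\<integral>\<^sup>+x. ennreal (C * inverse \<bar>t - x\<bar>) * indicator {a..b} x \<partial>lborel)"
      by simp
    also have "\<dots> \<le> I"
      unfolding I_def using ab
      by (intro nn_integral_mono) (auto simp: field_simps split: split_indicator)
    finally show ?thesis .
  qed
  show ?thesis
  proof (cases "I = \<infinity>")
    case False
    then obtain B where "B \<ge> 0" "I = ennreal B" by (cases I) auto
    then show ?thesis using ge[of "B + 1"] by simp
  qed (simp add: I_def)
qed

lemma AE_arclength_iff: "(AE t in arclength. P t) \<longleftrightarrow> (AE t in lebesgue. t \<in> {0..2 * pi} \<longrightarrow> P t)"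
  by (rule AE_restrict_space_iff) simp

lemma unit_speed_shift:
  assumes per: "\<And>x. c (x + P) = c x" and y: "unit_speed_at c y"
  shows "unit_speed_at c (y + P)"
    and "vector_derivative c (at (y + P)) = vector_derivative c (at y)"
proof -
  have "((c \<circ> (\<lambda>u. u - P)) has_vector_derivative 1 *\<^sub>R vector_derivative c (at y)) (at (y + P))"
  proof (rule vector_diff_chain_at)
    show "((\<lambda>u. u - P) has_vector_derivative 1) (at (y + P))"
      by (auto intro!: derivative_eq_intros)
    show "(c has_vector_derivative vector_derivative c (at y)) (at (y + P - P))"
      using y by (simp add: unit_speed_at_def vector_derivative_works)
  qed
  moreover have "c \<circ> (\<lambda>u. u - P) = c"
  proof
    fix u show "(c \<circ> (\<lambda>u. u - P)) u = c u" using per[of "u - P"] by simp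
  qed
  ultimately have *: "(c has_vector_derivative vector_derivative c (at y)) (at (y + P))" by simp
  then show "vector_derivative c (at (y + P)) = vector_derivative c (at y)"
    by (rule vector_derivative_at)
  then show "unit_speed_at c (y + P)"
    using y differentiableI_vector[OF *] by (simp add: unit_speed_at_def)
qed

context convex_loop
begin

lemma AE_unit_speed: "AE t in arclength. unit_speed_at c t"
proof -
  have "{t. \<not> unit_speed_at c t} \<in> null_sets lebesgue"
    using unit_speed by (simp add: negligible_iff_null_sets)
  then have "AE t in lebesgue. unit_speed_at c t"
    by (auto dest!: AE_not_in)
  then show ?thesis unfolding AE_arclength_iff by auto
qed

end

section \<open>Divergence of the energy at a corner\<close>

context oriented_convex_loop
begin

text \<open>For \<open>y\<close> in an interval of length \<open>r\<close> after the corner, up to a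
  period, the numerator is at least \<open>K * r\<close> and the distance at most
  \<open>M * r\<close>. The integrand is then at least \<open>C * r powr (-1 - s)\<close>, and the
  length of the interval supplies one power of \<open>r\<close>.\<close>

lemma kernel_integral_ge_near_corner:
  assumes corner: "corner_at t0" and t0: "0 < t0" "t0 \<le> 2 * pi" and s: "s > 0"
  obtains C r0 where "C > 0" "r0 > 0" "r0 \<le> t0"
    "\<And>r. 0 < r \<Longrightarrow> r < r0 \<Longrightarrow> ennreal (C * r powr (- s)) \<le>
       (\<integral>\<^sup>+y. ennreal (\<epsilon> * ((perp (tangent y) \<bullet> (c y - c (t0 - r))) / norm (c y - c (t0 - r)) powr (2 + s))) \<partial>arclength)"
proof -
  obtain K \<delta> where K: "K > 0" "\<delta> > 0" and
    corner_ge: "\<And>x y. t0 - \<delta> < x \<Longrightarrow> x < t0 \<Longrightarrow> t0 < y \<Longrightarrow> y < t0 + \<delta> \<Longrightarrow>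
     unit_speed_at c y \<Longrightarrow> K * (t0 - x) \<le> outer_normal y \<bullet> (c y - c x)"
    using corner unfolding corner_at_def by blast
  \<comment> \<open>The period shift keeps the integration interval to the right of \<open>t0\<close> inside \<open>{0..2 * pi}\<close>.\<close>
  define b where "b = (if t0 = 2 * pi then 0 else t0)"
  define P where "P = t0 - b"
  have b: "0 \<le> b" "b < 2 * pi" using t0 by (auto simp: b_def)
  have "P = 0 \<or> P = 2 * pi" by (auto simp: P_def b_def)
  then have per: "c (x + P) = c x" for x by (auto simp: eq_iff cis_mult[symmetric])
  \<comment> \<open>The shifted \<open>y\<close> and \<open>x\<close> are less than
    \<open>2 * r\<close> apart, which gives the Lipschitz bound \<open>M * r\<close> on the
    distance.\<close>
  define M where "M = 2 * (L + 1)"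
  have L: "L \<ge> 0" using lipschitz by (rule lipschitz_on_nonneg)
  then have M: "M > 0" by (simp add: M_def)
  define C where "C = K / M powr (2 + s)"
  have C: "C > 0" using K M by (simp add: C_def)
  \<comment> \<open>The three bounds keep both parameters within the range of the corner estimate,
    \<open>t0 - r\<close> positive, and the integration interval inside
    \<open>{0..2 * pi}\<close>.\<close>
  define r0 where "r0 = min \<delta> (min t0 (2 * pi - b))"
  have r0: "r0 > 0" "r0 \<le> t0" "r0 \<le> \<delta>" "b + r0 \<le> 2 * pi"
    using K t0 b by (auto simp: r0_def)
  have "ennreal (C * r powr (- s)) \<le>
       (\<integral>\<^sup>+y. ennreal (\<epsilon> * ((perp (tangent y) \<bullet> (c y - c (t0 - r))) / norm (c y - c (t0 - r)) powr (2 + s))) \<partial>arclength)"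
    if r: "0 < r" "r < r0" for r
  proof -
    define x where "x = t0 - r"
    have pointwise: "C * r powr (-1 - s) \<le>
        \<epsilon> * ((perp (tangent y) \<bullet> (c y - c x)) / norm (c y - c x) powr (2 + s))"
      if y: "b < y" "y < b + r" "unit_speed_at c y" for y
    proof -
      have shift: "unit_speed_at c (y + P)" "tangent (y + P) = tangent y"
        using unit_speed_shift[OF per y(3)] by auto
      have "K * (t0 - x) \<le> outer_normal (y + P) \<bullet> (c (y + P) - c x)"
        using r r0 y shift(1) by (intro corner_ge) (auto simp: x_def P_def)
      then have num: "K * r \<le> \<epsilon> * (perp (tangent y) \<bullet> (c y - c x))"
        by (simp add: shift(2) per x_def)
      have "K * r > 0" using K r by simp
      \<comment> \<open>A positive denominator matters here: at \<open>c y = c x\<close> the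
        quotient would be \<open>0\<close> by convention.\<close>
      then have "c y \<noteq> c x" using num by auto
      then have pos: "norm (c y - c x) > 0" by simp
      have "norm (c y - c x) \<le> L * \<bar>y + P - x\<bar>" using norm_diff_le[of "y + P" x] by (simp add: per)
      also have "\<dots> \<le> (L + 1) * (2 * r)"
        using y r L by (intro mult_mono) (auto simp: x_def P_def)
      finally have "norm (c y - c x) \<le> M * r" by (simp add: M_def algebra_simps)
      then have den: "norm (c y - c x) powr (2 + s) \<le> (M * r) powr (2 + s)"
        using s by (intro powr_mono2) auto
      have "r powr (-1 - s) = r / r powr (2 + s)"
        using r powr_diff[of r 1 "2 + s"] by simp
      then have "C * r powr (-1 - s) = K * r / (M * r) powr (2 + s)"
        using M r by (simp add: C_def powr_mult)
      also have "\<dots> \<le> \<epsilon> * (perp (tangent y) \<bullet> (c y - c x)) / norm (c y - c x) powr (2 + s)"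
        using num den pos \<open>K * r > 0\<close> by (intro frac_le) auto
      finally show ?thesis by simp
    qed
    have sets: "{b<..<b + r} \<in> sets arclength"
      using b r r0 by (subst sets_restrict_space_iff) auto
    have "emeasure arclength {b<..<b + r} = emeasure lebesgue {b<..<b + r}"
      using b r r0 by (intro emeasure_restrict_space) auto
    also have "\<dots> = ennreal r" using r by simp
    finally have meas: "emeasure arclength {b<..<b + r} = ennreal r" .
    have "C * r powr (- s) = C * r powr (-1 - s) * r"
      using r powr_add[of r "-1 - s" 1] by simp
    then have "ennreal (C * r powr (- s)) = ennreal (C * r powr (-1 - s)) * emeasure arclength {b<..<b + r}"
      using r C by (simp add: meas ennreal_mult mult.assoc)
    also have "\<dots> = (\<integral>\<^sup>+y. ennreal (C * r powr (-1 - s)) * indicator {b<..<b + r} y \<partial>arclength)"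
      using sets by (rule nn_integral_cmult_indicator[symmetric])
    also have "\<dots> \<le> (\<integral>\<^sup>+y. ennreal (\<epsilon> * ((perp (tangent y) \<bullet> (c y - c x)) / norm (c y - c x) powr (2 + s))) \<partial>arclength)"
    proof (rule nn_integral_mono_AE)
      show "AE y in arclength. ennreal (C * r powr (-1 - s)) * indicator {b<..<b + r} y \<le>
          ennreal (\<epsilon> * ((perp (tangent y) \<bullet> (c y - c x)) / norm (c y - c x) powr (2 + s)))"
        using AE_unit_speed
      proof eventually_elim
        case (elim y)
        then show ?case using pointwise[of y] by (auto split: split_indicator intro!: ennreal_leI)
      qed
    qed
    finally show ?thesis by (simp add: x_def)
  qed
  then show ?thesis using that[OF C r0(1,2)] by blast
qed

text \<open>The outer integral is compared with that of a multiple of \<open>1 / (t0 - x)\<close>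
  just to the left of the corner. With \<open>t0 > 0\<close> such an interval fits into
  \<open>{0..2 * pi}\<close>.\<close>

lemma W_energy_corner:
  assumes c: "c = (\<lambda>t. \<gamma> (cis t))" and corner: "corner_at t0"
    and t0: "0 < t0" "t0 \<le> 2 * pi" and s: "s > 0" and p: "p \<ge> 1 / s"
  shows "W_energy s p \<gamma> = \<infinity>"
proof -
  define k where "k x y = (perp (tangent y) \<bullet> (c y - c x)) / norm (c y - c x) powr (2 + s)" for x y
  have p0: "p \<ge> 0" using s p by (meson divide_nonneg_pos order_trans zero_le_one)
  have sp: "s * p \<ge> 1" using s p by (simp add: field_simps)
  have kernel: "e2ennreal \<bar>ext_integral arclength (k x)\<bar> = (\<integral>\<^sup>+y. ennreal (\<epsilon> * k x y) \<partial>arclength)" for x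
  proof (rule e2ennreal_abs_ext_integral[OF orientation])
    show "AE y in arclength. 0 \<le> \<epsilon> * k x y"
      using AE_unit_speed
    proof eventually_elim
      case (elim y)
      then show ?case using divide_nonneg_nonneg[OF outward[OF elim, of x]] by (simp add: k_def)
    qed
  qed
  have W: "W_energy s p \<gamma> =
      (\<integral>\<^sup>+x. ennreal_powr (\<integral>\<^sup>+y. ennreal (\<epsilon> * k x y) \<partial>arclength) p \<partial>arclength)"
    unfolding kernel[symmetric] by (simp add: W_energy_def k_def[abs_def] c normal_def arc_deriv_def)
  obtain C r0 where C: "C > 0" "r0 > 0" "r0 \<le> t0" and
    *: "\<And>r. 0 < r \<Longrightarrow> r < r0 \<Longrightarrow> ennreal (C * r powr (- s)) \<le> (\<integral>\<^sup>+y. ennreal (\<epsilon> * k (t0 - r) y) \<partial>arclength)"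
    unfolding k_def by (rule kernel_integral_ge_near_corner[OF corner t0 s]) blast
  \<comment> \<open>For \<open>r \<le> 1\<close> the inequality \<open>s * p \<ge> 1\<close> gives
    \<open>1 / r \<le> r powr (- (s * p))\<close>.\<close>
  define r1 where "r1 = min r0 1"
  have r1: "r1 > 0" "r1 \<le> r0" "r1 \<le> 1" using C by (auto simp: r1_def)
  have "(\<integral>\<^sup>+x. ennreal (C powr p / (t0 - x)) * indicator {t0 - r1<..<t0} x \<partial>lborel) = \<infinity>"
    using r1 C by (intro nn_integral_inverse_distance) auto
  then have "\<infinity> = (\<integral>\<^sup>+x. ennreal (C powr p / (t0 - x)) * indicator {t0 - r1<..<t0} x \<partial>lebesgue)"
    by (simp add: nn_integral_completion)
  also have "\<dots> = (\<integral>\<^sup>+x. ennreal (C powr p / (t0 - x)) * indicator {t0 - r1<..<t0} x * indicator {0..2 * pi} x \<partial>lebesgue)"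
    using r1 C t0 by (intro nn_integral_cong) (auto split: split_indicator)
  also have "\<dots> = (\<integral>\<^sup>+x. ennreal (C powr p / (t0 - x)) * indicator {t0 - r1<..<t0} x \<partial>arclength)"
    by (subst nn_integral_restrict_space) simp_all
  also have "\<dots> \<le> W_energy s p \<gamma>"
    unfolding W
  proof (rule nn_integral_mono)
    fix x
    show "ennreal (C powr p / (t0 - x)) * indicator {t0 - r1<..<t0} x
        \<le> ennreal_powr (\<integral>\<^sup>+y. ennreal (\<epsilon> * k x y) \<partial>arclength) p"
    proof (cases "x \<in> {t0 - r1<..<t0}")
      case True
      define r where "r = t0 - x"
      have r: "0 < r" "r < r1" "x = t0 - r" using True by (auto simp: r_def)
      have "1 / r = r powr (- 1)" using r by (simp add: powr_minus_divide)
      also have "\<dots> \<le> r powr (- (s * p))" using r r1 sp by (intro powr_mono') auto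
      finally have "C powr p / r \<le> C powr p * r powr (- (s * p))"
        using mult_left_mono[of "1 / r" _ "C powr p"] by simp
      also have "\<dots> = (C * r powr (- s)) powr p"
        using C r by (simp add: powr_mult powr_powr)
      finally have "ennreal (C powr p / r) \<le> ennreal_powr (ennreal (C * r powr (- s))) p"
        using C by (simp add: ennreal_powr_ennreal ennreal_leI)
      also have "\<dots> \<le> ennreal_powr (\<integral>\<^sup>+y. ennreal (\<epsilon> * k x y) \<partial>arclength) p"
        using *[of r] r r1 p0 by (intro ennreal_powr_mono) auto
      finally show ?thesis using True by (simp add: r_def)
    qed simp
  qed
  finally show ?thesis by (simp add: top_unique)
qed

lemma C1_if_finite_energy:
  assumes c: "c = (\<lambda>t. \<gamma> (cis t))" and s: "s > 0" and p: "p \<ge> 1 / s"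
    and finite: "W_energy s p \<gamma> < \<infinity>"
  shows "c C1_differentiable_on UNIV"
proof (rule strictly_differentiable_imp_C1)
  fix t :: real
  \<comment> \<open>A ceiling minus one instead of a floor: \<open>t - P\<close> has to lie in the
    period that is open at \<open>0\<close> and closed at \<open>2 * pi\<close>, as
    \<open>W_energy_corner\<close> demands.\<close>
  define n where "n = \<lceil>t / (2 * pi)\<rceil> - 1"
  define P where "P = 2 * pi * of_int n"
  have "of_int n < t / (2 * pi)" "t / (2 * pi) \<le> of_int n + 1"
    unfolding n_def by linarith+
  then have t0: "0 < t - P" "t - P \<le> 2 * pi"
    using pi_gt_zero by (simp_all add: P_def field_simps)
  have "cis (x - P) = cis x" for x
    using cis_multiple_2pi[of "of_int n"] by (simp add: P_def cis_divide[symmetric])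
  then have per: "c (x - P) = c x" for x by (simp add: c)
  have "\<not> corner_at (t - P)"
    using W_energy_corner[OF c _ t0 s p] finite by auto
  then obtain d where d: "strictly_differentiable_at c d (t - P)"
    using strictly_differentiable_or_corner by blast
  have "strictly_differentiable_at c d t"
    unfolding strictly_differentiable_at_def
  proof (intro allI impI)
    fix \<eta> :: real assume "\<eta> > 0"
    then obtain \<delta> where "\<delta> > 0" and \<delta>: "\<And>x y. \<bar>x - (t - P)\<bar> < \<delta> \<Longrightarrow> \<bar>y - (t - P)\<bar> < \<delta> \<Longrightarrow>
        norm (c y - c x - (y - x) *\<^sub>R d) \<le> \<eta> * \<bar>y - x\<bar>"
      using d unfolding strictly_differentiable_at_def by blast
    have "norm (c y - c x - (y - x) *\<^sub>R d) \<le> \<eta> * \<bar>y - x\<bar>"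
      if "\<bar>x - t\<bar> < \<delta>" "\<bar>y - t\<bar> < \<delta>" for x y
      using \<delta>[of "x - P" "y - P"] that by (simp add: per)
    then show "\<exists>\<delta>>0. \<forall>x y. \<bar>x - t\<bar> < \<delta> \<longrightarrow> \<bar>y - t\<bar> < \<delta> \<longrightarrow>
        norm (c y - c x - (y - x) *\<^sub>R d) \<le> \<eta> * \<bar>y - x\<bar>"
      using \<open>\<delta> > 0\<close> by blast
  qed
  then show "\<exists>d. strictly_differentiable_at c d t" by blast
qed

end

section \<open>From the circle to the real line\<close>

lemma lipschitz_on_cis: "1-lipschitz_on UNIV cis"
proof (rule bounded_derivative_imp_lipschitz)
  fix x :: real
  show "(cis has_derivative (\<lambda>t. t *\<^sub>R (\<i> * cis x))) (at x within UNIV)"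
    using has_derivative_cis[OF has_derivative_ident] by simp
  show "onorm (\<lambda>t. t *\<^sub>R (\<i> * cis x)) \<le> 1"
    by (rule onorm_bound) (simp_all add: norm_mult)
qed simp_all

text \<open>The unit speed hypothesis covers one period only; on the whole line the exceptional set
  lies in the countable union of the translates of \<open>N\<close> by multiples of
  \<open>2 * pi\<close>, which is negligible.\<close>

lemma convex_loop_if_convex_in_circle:
  assumes lip: "L-lipschitz_on circle \<gamma>" and inj: "inj_on \<gamma> circle"
    and unit: "AE t in arclength. unit_speed_at (\<lambda>u. \<gamma> (cis u)) t"
    and conv: "convex_in_circle \<gamma>"
  shows "convex_loop (\<lambda>t. \<gamma> (cis t)) L"
proof
  have "(L * 1)-lipschitz_on UNIV (\<lambda>t. \<gamma> (cis t))"
    using lipschitz_on_cis by (rule lipschitz_on_compose2) (rule lipschitz_on_subset[OF lip], auto)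
  then show "L-lipschitz_on UNIV (\<lambda>t. \<gamma> (cis t))" by simp
  show "\<gamma> (cis x) = \<gamma> (cis y) \<longleftrightarrow> cis x = cis y" for x y
    using inj by (auto simp: inj_on_def)
  show "\<exists>\<nu>. norm \<nu> = 1 \<and> (\<forall>u. 0 \<le> \<nu> \<bullet> (\<gamma> (cis t) - \<gamma> (cis u)))" for t
    using conv unfolding convex_in_circle_def by force
  define N where "N = {t \<in> {0..2 * pi}. \<not> unit_speed_at (\<lambda>u. \<gamma> (cis u)) t}"
  have "AE t in lebesgue. t \<notin> N"
    using unit unfolding AE_arclength_iff N_def by auto
  then obtain N' where "N \<subseteq> N'" "N' \<in> null_sets lebesgue"
    by (rule AE_E3) auto
  then have N: "negligible N"
    using negligible_iff_null_sets negligible_subset by blast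
  have "{t. \<not> unit_speed_at (\<lambda>u. \<gamma> (cis u)) t} \<subseteq> (\<Union>n::int. (+) (2 * pi * of_int n) ` N)"
  proof
    fix t assume t: "t \<in> {t. \<not> unit_speed_at (\<lambda>u. \<gamma> (cis u)) t}"
    define n where "n = \<lfloor>t / (2 * pi)\<rfloor>"
    define P where "P = 2 * pi * of_int n"
    have "of_int n \<le> t / (2 * pi)" "t / (2 * pi) \<le> of_int n + 1"
      unfolding n_def by linarith+
    then have t0: "0 \<le> t - P" "t - P \<le> 2 * pi"
      using pi_gt_zero by (simp_all add: P_def field_simps)
    have "cis (x + P) = cis x" for x
      using cis_multiple_2pi[of "of_int n"] by (simp add: P_def cis_mult[symmetric])
    then have "\<not> unit_speed_at (\<lambda>u. \<gamma> (cis u)) (t - P)"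
      using t unit_speed_shift(1)[of "\<lambda>u. \<gamma> (cis u)" P "t - P"] by auto
    then have "t - P \<in> N" using t0 by (simp add: N_def)
    moreover have "t = P + (t - P)" by simp
    ultimately show "t \<in> (\<Union>n::int. (+) (2 * pi * of_int n) ` N)"
      unfolding P_def by blast
  qed
  moreover have "negligible (\<Union>n::int. (+) (2 * pi * of_int n) ` N)"
    using N by (intro negligible_countable_Union) (auto intro!: negligible_translation)
  ultimately show "negligible {t. \<not> unit_speed_at (\<lambda>u. \<gamma> (cis u)) t}"
    by (rule negligible_subset[rotated])
qed

theorem theorem6p1:
  fixes \<gamma> :: "complex \<Rightarrow> real ^ 2" and s p :: real
  assumes lipschitz: "\<exists>L. L-lipschitz_on circle \<gamma>"
    and homeo: "\<exists>g. homeomorphism circle (\<gamma> ` circle) \<gamma> g"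
    and unit_speed: "AE t in arclength. (\<lambda>u. \<gamma> (cis u)) differentiable (at t) \<and>
                       norm (arc_deriv \<gamma> t) = 1"
    and conv: "convex_in_circle \<gamma>"
    and s: "0 < s" "s < 1"
    and p: "p \<ge> 1 / s"
    and finite_energy: "W_energy s p \<gamma> < \<infinity>"
  shows "(\<lambda>t. \<gamma> (cis t)) C1_differentiable_on UNIV"
proof -
  obtain L where L: "L-lipschitz_on circle \<gamma>" using lipschitz by blast
  have "inj_on \<gamma> circle"
    using homeo unfolding homeomorphism_def by (metis inj_on_inverseI)
  moreover have "AE t in arclength. unit_speed_at (\<lambda>u. \<gamma> (cis u)) t"
    using unit_speed unfolding unit_speed_at_def arc_deriv_def .
  ultimately interpret convex_loop "\<lambda>t. \<gamma> (cis t)" L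
    using L conv by (intro convex_loop_if_convex_in_circle)
  obtain \<epsilon> :: real where \<epsilon>: "\<epsilon> = 1 \<or> \<epsilon> = -1"
    "\<And>t u. unit_speed_at (\<lambda>t. \<gamma> (cis t)) t \<Longrightarrow> \<epsilon> * (perp (tangent t) \<bullet> (\<gamma> (cis t) - \<gamma> (cis u))) \<ge> 0"
    by (rule ex_orientation) blast
  interpret oriented_convex_loop "\<lambda>t. \<gamma> (cis t)" L \<epsilon>
    by unfold_locales (use \<epsilon> in auto)
  show ?thesis using s(1) p finite_energy by (intro C1_if_finite_energy) auto
qed

end
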